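(* Let $N$ be a finite index set, let $P \subseteq \mathbb{R}^N$ be a rational polyhedron and let $S, T \subseteq N$. Then the following are equivalent: (i) $x_T$ is implied integer by $x_S$ for $P$, i.e., $\mathrm{conv}(P \cap \mathcal{M}^S) = \mathrm{conv}(P \cap \mathcal{M}^{S\cup T})$. (ii) Every minimal face of $\mathrm{conv}(P \cap \mathcal{M}^S)$ contains a point $x \in \mathcal{M}^{S \cup T}$. (iii) For each $c \in \mathbb{R}^N$ for which $\max \{c^\intercal x \mid x \in \mathrm{conv}(P \cap \mathcal{M}^S)\}$ is finite, this maximum has some optimal solution $x^\star \in \mathcal{M}^{S \cup T}$. (iv) For each $\bar{x} \in \mathbb{Z}^S$ and every minimal face $F$ of $Q_S(\bar{x})$, $F \subseteq \mathrm{conv}(P \cap \mathcal{M}^{S \cup T})$. (v) $Q_S(\bar{x}) \subseteq \mathrm{conv}(P \cap \mathcal{M}^{S \cup T})$ holds for each $\bar{x} \in \mathbb{Z}^S$.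
   Context: For $S \subseteq N$, $\mathcal{M}^S \coloneqq \{ x \in \mathbb{R}^N \mid x_i \in \mathbb{Z} \ \forall i \in S \}$. For $S,T\subseteq N$, $x_T$ is called implied integer by $x_S$ for $P$ if $\mathrm{conv}(P \cap \mathcal{M}^S) = \mathrm{conv}(P \cap \mathcal{M}^{S \cup T})$. For $\bar{x} \in \mathbb{Z}^S$, the $S$-integral fiber is $Q_S(\bar{x}) \coloneqq \{ x \in P \mid x_S = \bar{x} \}$; when $S=\emptyset$, $\mathbb{Z}^\emptyset$ consists of a single element $\bar x$ with $Q_\emptyset(\bar x)=P$. *)

theory Defs
  imports "HOL-Analysis.Analysis"
begin

definition rational_polyhedron :: "(real^'n) set \<Rightarrow> bool" where
  "rational_polyhedron P \<longleftrightarrow>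
     (\<exists>H :: ((real^'n) \<times> real) set. finite H \<and>
        (\<forall>(a, b) \<in> H. (\<forall>i. a $ i \<in> \<rat>) \<and> b \<in> \<rat>) \<and>
        P = {x. \<forall>(a, b) \<in> H. a \<bullet> x \<le> b})"

definition mixed_integer_set :: "'n set \<Rightarrow> (real^'n) set" where
  "mixed_integer_set S = {x. \<forall>i \<in> S. x $ i \<in> \<int>}"

definition implied_integer :: "(real^'n) set \<Rightarrow> 'n set \<Rightarrow> 'n set \<Rightarrow> bool" where
  "implied_integer P S T \<longleftrightarrow>
     convex hull (P \<inter> mixed_integer_set S) = convex hull (P \<inter> mixed_integer_set (S \<union> T))"

text \<open>The set of integer vectors indexed by \<open>S\<close> is rendered as the set of extensional functions
  \<open>S \<rightarrow>\<^sub>E UNIV\<close>, which is a singleton for empty \<open>S\<close>.\<close>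

definition integral_fiber :: "(real^'n) set \<Rightarrow> 'n set \<Rightarrow> ('n \<Rightarrow> int) \<Rightarrow> (real^'n) set" where
  "integral_fiber P S xbar = {x \<in> P. \<forall>i \<in> S. x $ i = of_int (xbar i)}"

text \<open>Faces are the sets cut out by a valid inequality, as usual in polyhedral theory. The library's
  \<open>exposed_face_of\<close> admits the whole set (zero normal vector) and the empty set; the latter has to
  be excluded when speaking about minimal faces.\<close>

definition minimal_face_of :: "(real^'n) set \<Rightarrow> (real^'n) set \<Rightarrow> bool"
    (infix \<open>minimal'_face'_of\<close> 50) where
  "F minimal_face_of C \<longleftrightarrow>
     F exposed_face_of C \<and> F \<noteq> {} \<and>
     (\<forall>G. G exposed_face_of C \<longrightarrow> G \<noteq> {} \<longrightarrow> G \<subseteq> F \<longrightarrow> G = F)"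

end

theory Submission
  imports Defs
begin

text \<open>Homogenising and running the double description procedure over the rationals writes \<open>P\<close> as
  \<open>conv V + cone R\<close> with \<open>V\<close>, \<open>R\<close> finite and \<open>R\<close> integral. By Meyer's argument the mixed-integer
  hulls of \<open>P\<close> for \<open>S\<close> and for \<open>S \<union> T\<close> are both of the form \<open>conv W + cone R\<close> with this same \<open>R\<close>.
  Hence the smaller one, \<open>D\<close>, is closed, and a functional separating a point of the larger hull (or
  of an integral fiber) from \<open>D\<close> is bounded above on \<open>D\<close>, so it is nonpositive on all recession
  directions involved and attains its maximum on the larger set along a face containing a minimal
  face; (iii) respectively (iv) puts a maximiser into \<open>D\<close>, a contradiction. A nonempty
  exposed face contains a minimal one because passing to a proper subface lowers the dimension.\<close>

section \<open>Finitely generated convex cones\<close>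

lemma convex_cone_sum:
  assumes "convex_cone K" "\<And>i. i \<in> I \<Longrightarrow> f i \<in> K"
  shows "sum f I \<in> K"
  using assms(2)
proof (induction I rule: infinite_finite_induct)
  case (insert i I)
  then show ?case by (simp add: convex_cone_add[OF assms(1)])
qed (auto simp: convex_cone_contains_0[OF assms(1)])

text \<open>The combinations on the right form a convex cone containing \<open>R\<close>, and every
  convex cone containing \<open>R\<close> contains them. One coefficient function on all of
  \<open>R\<close> lets later proofs split sums by sign or round the coefficients.\<close>

lemma convex_cone_hull_finite:
  assumes "finite R"
  shows "convex_cone hull R = {\<Sum>r\<in>R. f r *\<^sub>R r | f. \<forall>r\<in>R. 0 \<le> f r}" (is "_ = ?K")
proof
  have "R \<subseteq> ?K"
  proof
    fix s assume "s \<in> R"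
    then have "s = (\<Sum>r\<in>R. (if r = s then 1 else 0) *\<^sub>R r)"
      using assms by (simp add: if_distrib[of "\<lambda>c. c *\<^sub>R _"] cong: if_cong)
    then show "s \<in> ?K" by fastforce
  qed
  moreover have "convex_cone ?K"
    unfolding convex_cone_iff
  proof (intro conjI ballI allI impI)
    show "0 \<in> ?K" by (auto intro: exI[of _ "\<lambda>_. 0"])
  next
    fix x y assume "x \<in> ?K" "y \<in> ?K"
    then obtain f g where "\<forall>r\<in>R. 0 \<le> f r" "\<forall>r\<in>R. 0 \<le> g r"
        "x = (\<Sum>r\<in>R. f r *\<^sub>R r)" "y = (\<Sum>r\<in>R. g r *\<^sub>R r)" by blast
    then show "x + y \<in> ?K"
      by (intro CollectI exI[of _ "\<lambda>r. f r + g r"]) (simp add: scaleR_left_distrib sum.distrib)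
  next
    fix x and c :: real assume "x \<in> ?K" "0 \<le> c"
    then obtain f where "\<forall>r\<in>R. 0 \<le> f r" "x = (\<Sum>r\<in>R. f r *\<^sub>R r)" by blast
    with \<open>0 \<le> c\<close> show "c *\<^sub>R x \<in> ?K"
      by (intro CollectI exI[of _ "\<lambda>r. c * f r"]) (simp add: scaleR_right.sum)
  qed
  ultimately show "convex_cone hull R \<subseteq> ?K"
    by (rule hull_minimal)
  show "?K \<subseteq> convex_cone hull R"
    by (force intro: convex_cone_sum[OF convex_cone_convex_cone_hull] convex_cone_hull_mul hull_inc)
qed

text \<open>One step of the double description procedure: generators on the wrong side of the new
  hyperplane are replaced by the points where it meets the segments to those on the right side.\<close>

lemma convex_cone_hull_Int_halfspace:
  fixes R :: "'a::euclidean_space set"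
  assumes "finite R"
  shows "convex_cone hull R \<inter> {x. a \<bullet> x \<le> 0} =
    convex_cone hull ({r \<in> R. a \<bullet> r \<le> 0} \<union>
      (\<lambda>(p, n). (a \<bullet> p) *\<^sub>R n - (a \<bullet> n) *\<^sub>R p) ` ({p \<in> R. a \<bullet> p > 0} \<times> {n \<in> R. a \<bullet> n < 0}))"
    (is "?L = convex_cone hull (?Z \<union> ?g ` (?P \<times> ?N))")
proof
  let ?G = "convex_cone hull (?Z \<union> ?g ` (?P \<times> ?N))"
  show "?G \<subseteq> ?L"
  proof (rule hull_minimal)
    have "?g (p, n) \<in> convex_cone hull R" if "p \<in> ?P" "n \<in> ?N" for p n
    proof -
      have "(a \<bullet> p) *\<^sub>R n + (- (a \<bullet> n)) *\<^sub>R p \<in> convex_cone hull R"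
        using that by (intro convex_cone_hull_add convex_cone_hull_mul hull_inc) auto
      then show ?thesis by simp
    qed
    then show "?Z \<union> ?g ` (?P \<times> ?N) \<subseteq> ?L"
      by (auto simp: inner_diff_right intro: hull_inc)
    show "convex_cone ?L"
      using convex_cone_convex_cone_hull[of R] convex_cone_halfspace_le[of a]
      by (simp add: convex_cone_iff)
  qed
  show "?L \<subseteq> ?G"
  proof
    fix x assume "x \<in> ?L"
    then obtain f where f: "\<forall>r\<in>R. 0 \<le> f r" and x: "x = (\<Sum>r\<in>R. f r *\<^sub>R r)" and ax: "a \<bullet> x \<le> 0"
      using convex_cone_hull_finite[OF assms] by auto
    define E where "E = {r \<in> R. a \<bullet> r = 0}"
    have R: "R = ?P \<union> (?N \<union> E)" and disj: "?P \<inter> (?N \<union> E) = {}" "?N \<inter> E = {}"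
      by (auto simp: E_def)
    have fin: "finite ?P" "finite ?N" "finite E"
      using assms by (auto simp: E_def)
    have split: "(\<Sum>r\<in>R. h r) = (\<Sum>r\<in>?P. h r) + ((\<Sum>r\<in>?N. h r) + (\<Sum>r\<in>E. h r))"
      for h :: "'a \<Rightarrow> 'b::comm_monoid_add"
      using fin disj by (subst R) (simp add: sum.union_disjoint)
    \<comment> \<open>Here \<open>u\<close> is the total positive contribution to
      \<open>a \<bullet> x\<close> and \<open>v\<close> the absolute value of the negative one. As
      \<open>u \<le> v\<close>, the positive part can be cancelled completely against the share
      \<open>u / v\<close> of the negative part.\<close>
    define u where "u = (\<Sum>p\<in>?P. f p * (a \<bullet> p))"
    define v where "v = (\<Sum>n\<in>?N. f n * - (a \<bullet> n))"
    have "a \<bullet> x = (\<Sum>r\<in>R. f r * (a \<bullet> r))"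
      by (simp add: x inner_sum_right)
    also have "\<dots> = u - v"
      by (simp add: split u_def v_def sum_negf E_def)
    finally have uv: "u \<le> v" using ax by simp
    have u0: "0 \<le> u" unfolding u_def using f by (intro sum_nonneg) auto
    have G: "convex_cone ?G" by (rule convex_cone_convex_cone_hull)
    have EG: "(\<Sum>r\<in>E. f r *\<^sub>R r) \<in> ?G"
      using f by (intro convex_cone_sum[OF G] convex_cone_hull_mul hull_inc) (auto simp: E_def)
    have NG: "(\<Sum>r\<in>?N. f r *\<^sub>R r) \<in> ?G"
      using f by (intro convex_cone_sum[OF G] convex_cone_hull_mul hull_inc) auto
    show "x \<in> ?G"
    proof (cases "u = 0")
      case True
      then have "\<forall>p\<in>?P. f p * (a \<bullet> p) = 0"
        unfolding u_def using f fin by (subst (asm) sum_nonneg_eq_0_iff) auto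
      then have "(\<Sum>r\<in>?P. f r *\<^sub>R r) = 0" by (intro sum.neutral) auto
      then have "x = (\<Sum>r\<in>?N. f r *\<^sub>R r) + (\<Sum>r\<in>E. f r *\<^sub>R r)"
        unfolding x split by simp
      then show ?thesis using EG NG convex_cone_hull_add by auto
    next
      case False
      with u0 uv have v: "v > 0" by simp
      \<comment> \<open>Pairing every \<open>p\<close> with every \<open>n\<close>, weighted by the
        product of their coefficients, gives \<open>v\<close> times the positive part plus
        \<open>u\<close> times the negative part. Dividing by \<open>v\<close> leaves the share
        \<open>1 - u / v\<close> of the negative part to be added.\<close>
      have "(\<Sum>p\<in>?P. \<Sum>n\<in>?N. (f p * f n) *\<^sub>R ?g (p, n)) \<in> ?G" (is "?D \<in> _")
        using f by (intro convex_cone_sum[OF G] convex_cone_hull_mul hull_inc) auto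
      moreover have D: "?D = u *\<^sub>R (\<Sum>n\<in>?N. f n *\<^sub>R n) + v *\<^sub>R (\<Sum>p\<in>?P. f p *\<^sub>R p)"
      proof -
        have "?D = (\<Sum>p\<in>?P. \<Sum>n\<in>?N. (f p * (a \<bullet> p)) *\<^sub>R (f n *\<^sub>R n))
            + (\<Sum>p\<in>?P. \<Sum>n\<in>?N. (f n * - (a \<bullet> n)) *\<^sub>R (f p *\<^sub>R p))"
          unfolding sum.distrib[symmetric]
          by (intro sum.cong refl) (simp add: scaleR_diff_right mult_ac)
        also have "(\<Sum>p\<in>?P. \<Sum>n\<in>?N. (f p * (a \<bullet> p)) *\<^sub>R (f n *\<^sub>R n)) = u *\<^sub>R (\<Sum>n\<in>?N. f n *\<^sub>R n)"
          unfolding u_def scaleR_left.sum by (simp add: scaleR_right.sum)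
        also have "(\<Sum>p\<in>?P. \<Sum>n\<in>?N. (f n * - (a \<bullet> n)) *\<^sub>R (f p *\<^sub>R p)) = v *\<^sub>R (\<Sum>p\<in>?P. f p *\<^sub>R p)"
          unfolding v_def scaleR_left.sum scaleR_right.sum ..
        finally show ?thesis .
      qed
      moreover have "x = (1 / v) *\<^sub>R ?D + ((1 - u / v) *\<^sub>R (\<Sum>n\<in>?N. f n *\<^sub>R n) + (\<Sum>r\<in>E. f r *\<^sub>R r))"
        unfolding x split D using v by (simp add: scaleR_add_right scaleR_left_diff_distrib)
      moreover have "0 \<le> 1 / v" "0 \<le> 1 - u / v" using uv v by auto
      ultimately show ?thesis
        using EG NG by (auto intro!: convex_cone_hull_add convex_cone_hull_mul)
    qed
  qed
qed

text \<open>Induction on the inequalities. The whole space is generated by the signed basis vectors,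
  and each double description step forms only products and differences of rational numbers, so
  rationality survives.\<close>

lemma rational_cone_finitely_generated:
  fixes A :: "'a::euclidean_space set"
  assumes "finite A" "\<forall>a\<in>A. \<forall>i\<in>Basis. a \<bullet> i \<in> \<rat>"
  shows "\<exists>R. finite R \<and> (\<forall>r\<in>R. \<forall>i\<in>Basis. r \<bullet> i \<in> \<rat>) \<and> {x. \<forall>a\<in>A. a \<bullet> x \<le> 0} = convex_cone hull R"
  using assms
proof (induction A)
  case empty
  let ?R = "Basis \<union> uminus ` Basis :: 'a set"
  have "x \<in> convex_cone hull ?R" for x
  proof -
    have "(\<Sum>b\<in>Basis. \<bar>x \<bullet> b\<bar> *\<^sub>R (if x \<bullet> b \<ge> 0 then b else - b)) \<in> convex_cone hull ?R"
      by (intro convex_cone_sum convex_cone_convex_cone_hull convex_cone_hull_mul hull_inc) auto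
    also have "(\<Sum>b\<in>Basis. \<bar>x \<bullet> b\<bar> *\<^sub>R (if x \<bullet> b \<ge> 0 then b else - b)) = (\<Sum>b\<in>Basis. (x \<bullet> b) *\<^sub>R b)"
      by (intro sum.cong) auto
    finally show ?thesis by (simp add: euclidean_representation)
  qed
  moreover have "\<forall>r\<in>?R. \<forall>i\<in>Basis. r \<bullet> i \<in> \<rat>"
    by (auto simp: inner_Basis)
  ultimately show ?case
    by (intro exI[of _ ?R]) auto
next
  case (insert a A)
  then obtain R where R: "finite R" "\<forall>r\<in>R. \<forall>i\<in>Basis. r \<bullet> i \<in> \<rat>"
      "{x. \<forall>a\<in>A. a \<bullet> x \<le> 0} = convex_cone hull R" by auto
  have rat: "a \<bullet> r \<in> \<rat>" if "r \<in> R" for r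
    using R(2) insert.prems that by (subst euclidean_inner) (auto intro!: Rats_sum Rats_mult)
  define R' where "R' = {r \<in> R. a \<bullet> r \<le> 0} \<union>
      (\<lambda>(p, n). (a \<bullet> p) *\<^sub>R n - (a \<bullet> n) *\<^sub>R p) ` ({p \<in> R. a \<bullet> p > 0} \<times> {n \<in> R. a \<bullet> n < 0})"
  have "{x. \<forall>a\<in>insert a A. a \<bullet> x \<le> 0} = convex_cone hull R \<inter> {x. a \<bullet> x \<le> 0}"
    unfolding R(3)[symmetric] by auto
  also have "\<dots> = convex_cone hull R'"
    unfolding R'_def by (rule convex_cone_hull_Int_halfspace[OF R(1)])
  finally show ?case
    using R(1,2) rat by (intro exI[of _ R']) (auto simp: R'_def inner_diff_left)
qed

section \<open>Recession directions\<close>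

text \<open>Only scaling takes work: iteration yields all natural multiples of \<open>y\<close>, and
  for \<open>c < n\<close> the point \<open>x + c *\<^sub>R y\<close> lies on the segment from
  \<open>x\<close> to \<open>x + n *\<^sub>R y\<close>, which convexity keeps in
  \<open>C\<close>.\<close>

lemma convex_cone_recession_directions:
  assumes "convex C"
  shows "convex_cone {y. \<forall>x\<in>C. x + y \<in> C}"
  unfolding convex_cone_iff
proof (intro conjI ballI allI impI)
  fix x y assume "x \<in> {y. \<forall>x\<in>C. x + y \<in> C}" "y \<in> {y. \<forall>x\<in>C. x + y \<in> C}"
  then show "x + y \<in> {y. \<forall>x\<in>C. x + y \<in> C}" by (simp add: add.assoc[symmetric])
next
  fix y and c :: real assume y: "y \<in> {y. \<forall>x\<in>C. x + y \<in> C}" and c: "0 \<le> c"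
  have nat: "x + real n *\<^sub>R y \<in> C" if "x \<in> C" for x n
  proof (induction n)
    case (Suc n)
    with y have "x + real n *\<^sub>R y + y \<in> C" by blast
    then show ?case by (simp add: algebra_simps)
  qed (simp add: that)
  obtain n where n: "c < real n" using reals_Archimedean2 by blast
  have "x + c *\<^sub>R y \<in> C" if x: "x \<in> C" for x
  proof -
    have "(1 - c / n) *\<^sub>R x + (c / n) *\<^sub>R (x + real n *\<^sub>R y) \<in> C"
      using c n by (intro convexD[OF assms x nat[OF x]]) auto
    then show ?thesis using c n by (simp add: algebra_simps)
  qed
  then show "c *\<^sub>R y \<in> {y. \<forall>x\<in>C. x + y \<in> C}" by simp
qed simp

text \<open>The translations mapping \<open>C\<close> into itself form a convex cone, so testing the
  generators suffices.\<close>

lemma convex_add_convex_cone_hull: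
  assumes "convex C" "\<And>r x. r \<in> R \<Longrightarrow> x \<in> C \<Longrightarrow> x + r \<in> C"
  shows "C + convex_cone hull R \<subseteq> C"
proof -
  have "convex_cone hull R \<subseteq> {y. \<forall>x\<in>C. x + y \<in> C}"
    using assms by (intro hull_minimal convex_cone_recession_directions) auto
  then show ?thesis by (auto simp: set_plus_def)
qed

section \<open>Decomposition of rational polyhedra\<close>

lemma rational_vector_scale_integral:
  fixes r :: "real^'n"
  assumes "\<And>i. r $ i \<in> \<rat>"
  shows "\<exists>k>0. \<forall>i. (k *\<^sub>R r) $ i \<in> \<int>"
proof -
  have "\<exists>d::int. d > 0 \<and> of_int d * r $ i \<in> \<int>" for i
  proof -
    from assms[of i] obtain p q :: int where "q > 0" "r $ i = of_int p / of_int q"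
      by (auto elim!: Rats_cases')
    then have "of_int q * r $ i = of_int p" by simp
    with \<open>q > 0\<close> show ?thesis by (metis Ints_of_int)
  qed
  then obtain d :: "'n \<Rightarrow> int" where d: "\<And>i. d i > 0" "\<And>i. of_int (d i) * r $ i \<in> \<int>" by metis
  \<comment> \<open>The product of all denominators is a common one; removing factor
    \<open>i\<close> leaves an integer multiple of \<open>d i\<close>.\<close>
  let ?k = "real_of_int (\<Prod>i\<in>UNIV. d i)"
  have "?k * r $ i \<in> \<int>" for i
  proof -
    have "?k * r $ i = of_int (\<Prod>j\<in>UNIV - {i}. d j) * (of_int (d i) * r $ i)"
      by (simp add: prod.remove[of UNIV i])
    then show ?thesis using d(2)[of i] by (metis Ints_mult Ints_of_int)
  qed
  moreover have "?k > 0" using d(1) by (simp add: prod_pos)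
  ultimately show ?thesis by (intro exI[of _ ?k]) simp
qed

lemma polyhedron_coordinates_fixed: "polyhedron {x :: real^'n. \<forall>i\<in>S. x $ i = k i}"
proof -
  have "{x :: real^'n. \<forall>i\<in>S. x $ i = k i} = \<Inter> ((\<lambda>i. {x. axis i 1 \<bullet> x = k i}) ` S)"
    by (auto simp: inner_axis')
  also have "polyhedron \<dots>"
    by (intro polyhedron_Inter) (auto simp: polyhedron_hyperplane)
  finally show ?thesis .
qed

lemma rational_polyhedron_imp_polyhedron:
  assumes "rational_polyhedron P"
  shows "polyhedron P"
proof -
  obtain H where "finite H" "P = {x. \<forall>(a, b)\<in>H. a \<bullet> x \<le> b}"
    using assms unfolding rational_polyhedron_def by blast
  then have "P = \<Inter> ((\<lambda>(a, b). {x. a \<bullet> x \<le> b}) ` H)" by auto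
  with \<open>finite H\<close> show ?thesis
    by (auto intro!: polyhedron_Inter simp: polyhedron_halfspace_le)
qed

text \<open>\<open>P\<close> is the slice at height \<open>t = 1\<close> of its homogenisation, a
  rational cone. Generators of positive height are rescaled to height 1 and give \<open>V\<close>;
  those of height 0 are recession directions and are rescaled to integral vectors, giving
  \<open>R\<close>.\<close>

lemma rational_polyhedron_decomposition:
  fixes P :: "(real^'n) set"
  assumes "rational_polyhedron P"
  shows "\<exists>V R. finite V \<and> finite R \<and> R \<subseteq> mixed_integer_set UNIV \<and>
    P = convex hull V + convex_cone hull R"
proof -
  obtain H :: "((real^'n) \<times> real) set" where H: "finite H"
      "\<And>a b. (a, b) \<in> H \<Longrightarrow> (\<forall>i. a $ i \<in> \<rat>) \<and> b \<in> \<rat>"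
      "P = {x. \<forall>(a, b)\<in>H. a \<bullet> x \<le> b}"
    using assms by (fastforce simp: rational_polyhedron_def)
  \<comment> \<open>The extra pair \<open>(0, -1)\<close> encodes \<open>0 \<le> t\<close>.\<close>
  let ?A = "insert (0, -1) ((\<lambda>(a, b). (a, - b)) ` H) :: ((real^'n) \<times> real) set"
  have "\<forall>a\<in>?A. \<forall>i\<in>Basis. a \<bullet> i \<in> \<rat>"
    using H(2) by (auto simp: Basis_prod_def Basis_vec_def inner_axis)
  with H(1) obtain G where G: "finite G" "\<forall>r\<in>G. \<forall>i\<in>Basis. r \<bullet> i \<in> \<rat>"
      "{x. \<forall>a\<in>?A. a \<bullet> x \<le> 0} = convex_cone hull G"
    using rational_cone_finitely_generated[of ?A] by blast
  have G_iff: "(x, t) \<in> convex_cone hull G \<longleftrightarrow> 0 \<le> t \<and> (\<forall>(a, b)\<in>H. a \<bullet> x \<le> b * t)" for x t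
    unfolding G(3)[symmetric] by (auto simp: algebra_simps)
  have P_iff: "x \<in> P \<longleftrightarrow> (x, 1) \<in> convex_cone hull G" for x
    by (auto simp: G_iff H(3))
  have G_mem: "0 \<le> t" "\<forall>(a, b)\<in>H. a \<bullet> x \<le> b * t" if "(x, t) \<in> G" for x t
    using hull_inc[OF that, of convex_cone] by (auto simp: G_iff)
  have "\<exists>k>0. \<forall>i. (k *\<^sub>R r) $ i \<in> \<int>" if "(r, t) \<in> G" for r t
  proof (rule rational_vector_scale_integral)
    fix i
    have "(axis i 1, 0) \<in> (Basis :: ((real^'n) \<times> real) set)"
      by (auto simp: Basis_prod_def Basis_vec_def)
    with G(2) that have "(r, t) \<bullet> (axis i 1, 0) \<in> \<rat>" by blast
    then show "r $ i \<in> \<rat>" by (simp add: inner_axis)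
  qed
  then obtain k where k: "\<And>r t. (r, t) \<in> G \<Longrightarrow> k r > 0 \<and> (\<forall>i. (k r *\<^sub>R r) $ i \<in> \<int>)"
    by metis
  define V where "V = (\<lambda>(v, t). (1 / t) *\<^sub>R v) ` {(v, t) \<in> G. t > 0}"
  define R where "R = (\<lambda>(r, t). k r *\<^sub>R r) ` {(r, t) \<in> G. t = 0}"
  have "finite V" "finite R"
    unfolding V_def R_def using G(1) by (auto intro!: finite_imageI intro: finite_subset[of _ G])
  moreover have "R \<subseteq> mixed_integer_set UNIV"
    unfolding R_def mixed_integer_set_def using k by auto
  moreover have "P = convex hull V + convex_cone hull R"
  proof
    have "convex P"
      by (intro polyhedron_imp_convex rational_polyhedron_imp_polyhedron assms)
    moreover have "V \<subseteq> P"
      unfolding V_def H(3) using G_mem(2) by (fastforce simp: field_simps)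
    ultimately have "convex hull V \<subseteq> P" by (rule hull_minimal[rotated])
    then have "convex hull V + convex_cone hull R \<subseteq> P + convex_cone hull R"
      by (rule set_plus_mono2) simp
    also have "\<dots> \<subseteq> P"
    proof (rule convex_add_convex_cone_hull[OF \<open>convex P\<close>])
      fix s x assume "s \<in> R" "x \<in> P"
      then obtain r where r: "(r, 0) \<in> G" "s = k r *\<^sub>R r" unfolding R_def by auto
      have "a \<bullet> (x + s) \<le> b" if "(a, b) \<in> H" for a b
      proof -
        have "a \<bullet> r \<le> 0" using G_mem(2)[OF r(1)] that by auto
        with k[OF r(1)] have "a \<bullet> s \<le> 0" by (simp add: r(2) mult_nonneg_nonpos)
        moreover have "a \<bullet> x \<le> b" using \<open>x \<in> P\<close> that unfolding H(3) by auto
        ultimately show ?thesis by (simp add: inner_add_right)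
      qed
      then show "x + s \<in> P" unfolding H(3) by auto
    qed
    finally show "convex hull V + convex_cone hull R \<subseteq> P" .
    show "P \<subseteq> convex hull V + convex_cone hull R"
    proof
      fix x assume "x \<in> P"
      then obtain f where f: "\<forall>g\<in>G. 0 \<le> f g" "(x, 1) = (\<Sum>g\<in>G. f g *\<^sub>R g)"
        unfolding P_iff convex_cone_hull_finite[OF G(1)] by auto
      let ?P = "{(v, t) \<in> G. t > 0}" and ?Z = "{(r, t) \<in> G. t = 0}"
      have GPZ: "G = ?P \<union> ?Z" "?P \<inter> ?Z = {}" using G_mem(1) by fastforce+
      have fin: "finite ?P" "finite ?Z" using G(1) by (auto intro: finite_subset[of _ G])
      have split: "(\<Sum>g\<in>G. h g) = (\<Sum>g\<in>?P. h g) + (\<Sum>g\<in>?Z. h g)"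
        for h :: "_ \<Rightarrow> 'b::comm_monoid_add"
        using fin GPZ(2) by (subst GPZ(1)) (simp add: sum.union_disjoint)
      \<comment> \<open>In the last coordinate the generators of height 0 vanish, so the numbers
        \<open>f g * snd g\<close> on the others are convex weights for the rescaled points in
        \<open>V\<close>.\<close>
      have "1 = (\<Sum>g\<in>G. f g * snd g)"
        using arg_cong[OF f(2), of snd] by (simp add: snd_sum)
      then have one: "(\<Sum>g\<in>?P. f g * snd g) = 1"
        unfolding split by (simp add: case_prod_unfold)
      have "x = (\<Sum>g\<in>G. f g *\<^sub>R fst g)"
        using arg_cong[OF f(2), of fst] by (simp add: fst_sum)
      also have "\<dots> = (\<Sum>g\<in>?P. (f g * snd g) *\<^sub>R ((1 / snd g) *\<^sub>R fst g))
          + (\<Sum>g\<in>?Z. (f g / k (fst g)) *\<^sub>R (k (fst g) *\<^sub>R fst g))"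
        unfolding split
        by (intro arg_cong2[of _ _ _ _ "(+)"] sum.cong refl) (use k in fastforce)+
      also have "\<dots> \<in> convex hull V + convex_cone hull R"
      proof (rule set_plus_intro)
        show "(\<Sum>g\<in>?P. (f g * snd g) *\<^sub>R ((1 / snd g) *\<^sub>R fst g)) \<in> convex hull V"
          using f(1) by (intro convex_sum[OF fin(1) convex_convex_hull one] hull_inc)
            (force simp: V_def)+
        have "0 \<le> f g / k (fst g)" if "g \<in> ?Z" for g
          using f(1) k[of "fst g" "snd g"] that by auto
        then show "(\<Sum>g\<in>?Z. (f g / k (fst g)) *\<^sub>R (k (fst g) *\<^sub>R fst g)) \<in> convex_cone hull R"
          by (intro convex_cone_sum[OF convex_cone_convex_cone_hull] convex_cone_hull_mul hull_inc)
            (auto simp: R_def image_iff case_prod_unfold)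
      qed
      finally show "x \<in> convex hull V + convex_cone hull R" .
    qed
  qed
  ultimately show ?thesis by blast
qed

section \<open>Mixed-integer hulls\<close>

text \<open>Translation by \<open>r\<close> maps the mixed-integer points of \<open>P\<close> to
  such points, and translations commute with convex hulls.\<close>

lemma convex_hull_mixed_integer_add_integral:
  assumes "r \<in> mixed_integer_set UNIV" "\<And>x. x \<in> P \<Longrightarrow> x + r \<in> P"
    and "x \<in> convex hull (P \<inter> mixed_integer_set S)"
  shows "x + r \<in> convex hull (P \<inter> mixed_integer_set S)"
proof -
  have "(\<lambda>x. r + x) ` (P \<inter> mixed_integer_set S) \<subseteq> P \<inter> mixed_integer_set S"
    using assms(1,2) by (auto simp: mixed_integer_set_def add.commute)
  then have "(\<lambda>x. r + x) ` (convex hull (P \<inter> mixed_integer_set S)) \<subseteq> convex hull (P \<inter> mixed_integer_set S)"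
    by (metis convex_hull_translation hull_mono)
  with assms(3) show ?thesis by (auto simp: add.commute)
qed

text \<open>Boundedness leaves finitely many integer assignments on \<open>S\<close>. Each one cuts
  a polytope out of \<open>Z\<close>, and the generators of all these polytopes together generate
  the hull.\<close>

lemma polytope_mixed_integer_hull:
  fixes Z :: "(real^'n) set"
  assumes "polytope Z"
  shows "\<exists>W. finite W \<and> convex hull (Z \<inter> mixed_integer_set S) = convex hull W"
proof -
  obtain B where B: "\<And>x. x \<in> Z \<Longrightarrow> norm x \<le> B"
    using polytope_imp_bounded[OF assms] by (auto simp: bounded_iff)
  \<comment> \<open>Functions are taken extensional outside \<open>S\<close> so that there are only
    finitely many.\<close>
  define K where "K = S \<rightarrow>\<^sub>E {- \<lceil>B\<rceil>..\<lceil>B\<rceil>}"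
  have "finite K" unfolding K_def by (intro finite_PiE) auto
  have "polytope (Z \<inter> {x. \<forall>i\<in>S. x $ i = of_int (k i)})" for k :: "'n \<Rightarrow> int"
    by (intro polytope_Int_polyhedron assms polyhedron_coordinates_fixed)
  then obtain w where w: "\<And>k::'n \<Rightarrow> int. finite (w k)"
      "\<And>k. Z \<inter> {x. \<forall>i\<in>S. x $ i = of_int (k i)} = convex hull w k"
    unfolding polytope_def by metis
  have "Z \<inter> mixed_integer_set S = (\<Union>k\<in>K. convex hull w k)"
  proof
    show "Z \<inter> mixed_integer_set S \<subseteq> (\<Union>k\<in>K. convex hull w k)"
    proof
      fix x assume x: "x \<in> Z \<inter> mixed_integer_set S"
      let ?k = "restrict (\<lambda>i. \<lfloor>x $ i\<rfloor>) S"
      have "\<bar>x $ i\<bar> \<le> B" for i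
        using B x component_le_norm_cart order_trans by blast
      then have "- \<lceil>B\<rceil> \<le> \<lfloor>x $ i\<rfloor> \<and> \<lfloor>x $ i\<rfloor> \<le> \<lceil>B\<rceil>" for i
        using le_of_int_ceiling[of B] of_int_floor_le[of "x $ i"]
        by (smt (verit) le_floor_iff of_int_le_iff of_int_minus)
      then have "?k \<in> K" unfolding K_def by auto
      moreover have "x \<in> Z \<inter> {x. \<forall>i\<in>S. x $ i = of_int (?k i)}"
        using x by (auto simp: mixed_integer_set_def)
      ultimately show "x \<in> (\<Union>k\<in>K. convex hull w k)" using w(2) by blast
    qed
    show "(\<Union>k\<in>K. convex hull w k) \<subseteq> Z \<inter> mixed_integer_set S"
      unfolding w(2)[symmetric] by (auto simp: mixed_integer_set_def)
  qed
  moreover have "convex hull (\<Union>k\<in>K. convex hull w k) = convex hull (\<Union>k\<in>K. w k)"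
  proof (rule hull_unique)
    show "(\<Union>k\<in>K. convex hull w k) \<subseteq> convex hull (\<Union>k\<in>K. w k)"
      by (auto intro: subsetD[OF hull_mono, rotated])
    fix C assume "(\<Union>k\<in>K. convex hull w k) \<subseteq> C" "convex C"
    then show "convex hull (\<Union>k\<in>K. w k) \<subseteq> C"
      by (intro hull_minimal) (auto intro: hull_inc)
  qed simp
  ultimately show ?thesis
    using \<open>finite K\<close> w(1) by (intro exI[of _ "\<Union>k\<in>K. w k"]) simp
qed

text \<open>Meyer's theorem. Subtracting the integral part of the conic coefficients moves every
  mixed-integer point of \<open>P\<close> into a fixed box, without leaving \<open>P\<close> or the mixed-integer lattice.\<close>

lemma mixed_integer_hull_decomposition:
  fixes P :: "(real^'n) set"
  assumes P: "polyhedron P" "P = convex hull V + convex_cone hull R"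
    and fin: "finite V" "finite R" and R: "R \<subseteq> mixed_integer_set UNIV"
  shows "\<exists>W. finite W \<and> convex hull (P \<inter> mixed_integer_set S) = convex hull W + convex_cone hull R"
proof -
  let ?M = "mixed_integer_set S" and ?K = "convex_cone hull R"
  have "bounded (convex hull V)"
    using fin(1) by (simp add: finite_imp_bounded bounded_convex_hull)
  then obtain A where A: "\<And>v. v \<in> convex hull V \<Longrightarrow> norm v \<le> A" by (auto simp: bounded_iff)
  \<comment> \<open>This bounds a point of \<open>convex hull V\<close> plus a conic combination
    with all coefficients below 1. A box around the ball is used below because its intersection with
    \<open>P\<close> is again a polytope.\<close>
  let ?B = "A + (\<Sum>r\<in>R. norm r)"
  obtain b :: "real^'n" where b: "cball 0 ?B \<subseteq> cbox (- b) b"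
    using bounded_subset_cbox_symmetric[OF bounded_cball, of 0 ?B] by auto
  let ?Q = "cbox (- b) b"
  obtain W where W: "finite W" "convex hull (?Q \<inter> P \<inter> ?M) = convex hull W"
    using polytope_mixed_integer_hull polytope_Int_polyhedron[OF polytope_interval P(1)] by blast
  have add: "x + y \<in> P" if "x \<in> P" "y \<in> ?K" for x y
    using that convex_cone_hull_add unfolding P(2) set_plus_def
    by (fastforce simp: add.assoc)
  have "convex hull (P \<inter> ?M) = convex hull W + ?K"
  proof
    have "P \<inter> ?M \<subseteq> convex hull W + ?K"
    proof
      fix x assume x: "x \<in> P \<inter> ?M"
      then obtain v f where v: "v \<in> convex hull V" and f: "\<forall>r\<in>R. 0 \<le> f r"
          and xv: "x = v + (\<Sum>r\<in>R. f r *\<^sub>R r)"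
        unfolding P(2) set_plus_def convex_cone_hull_finite[OF fin(2)] by auto
      define z where "z = v + (\<Sum>r\<in>R. frac (f r) *\<^sub>R r)"
      define y where "y = (\<Sum>r\<in>R. of_int \<lfloor>f r\<rfloor> *\<^sub>R r)"
      have "f r *\<^sub>R r = frac (f r) *\<^sub>R r + of_int \<lfloor>f r\<rfloor> *\<^sub>R r" for r
        by (simp add: frac_def scaleR_left_diff_distrib)
      then have xzy: "x = z + y" by (simp add: xv z_def y_def sum.distrib)
      have y: "y \<in> ?K" unfolding y_def using f
        by (intro convex_cone_sum[OF convex_cone_convex_cone_hull] convex_cone_hull_mul hull_inc) auto
      have "(\<Sum>r\<in>R. frac (f r) *\<^sub>R r) \<in> ?K"
        by (intro convex_cone_sum[OF convex_cone_convex_cone_hull] convex_cone_hull_mul hull_inc) auto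
      then have "z \<in> P" unfolding z_def P(2) using v by (rule set_plus_intro[rotated])
      moreover have "z \<in> ?Q"
      proof -
        have "norm z \<le> norm v + (\<Sum>r\<in>R. norm (frac (f r) *\<^sub>R r))"
          unfolding z_def by (intro order_trans[OF norm_triangle_ineq] add_mono norm_sum order_refl)
        also have "\<dots> \<le> ?B"
          using A[OF v] by (intro add_mono sum_mono) (auto intro!: mult_left_le_one_le less_imp_le[OF frac_lt_1])
        finally show ?thesis using b by auto
      qed
      moreover have "z \<in> ?M"
      proof -
        have "y $ i \<in> \<int>" for i
          unfolding y_def using R by (auto simp: mixed_integer_set_def intro!: Ints_sum Ints_mult)
        moreover have "z $ i = x $ i - y $ i" for i by (simp add: xzy)
        ultimately show ?thesis using x by (auto simp: mixed_integer_set_def)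
      qed
      ultimately have "z \<in> convex hull W"
        unfolding W(2)[symmetric] by (intro hull_inc) auto
      with y show "x \<in> convex hull W + ?K" unfolding xzy by (intro set_plus_intro)
    qed
    then show "convex hull (P \<inter> ?M) \<subseteq> convex hull W + ?K"
      by (intro hull_minimal convex_set_plus convex_convex_hull convex_convex_cone_hull)
    \<comment> \<open>Conversely, the elements of \<open>R\<close> are integral recession directions
      of \<open>P\<close>, so the mixed-integer hull absorbs the cone they generate.\<close>
    have "convex hull W + ?K \<subseteq> convex hull (P \<inter> ?M) + ?K"
      unfolding W(2)[symmetric] by (intro set_plus_mono2 hull_mono) auto
    also have "\<dots> \<subseteq> convex hull (P \<inter> ?M)"
      using R add by (intro convex_add_convex_cone_hull convex_convex_hull
          convex_hull_mixed_integer_add_integral) (auto intro: hull_inc)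
    finally show "convex hull W + ?K \<subseteq> convex hull (P \<inter> ?M)" .
  qed
  with W(1) show ?thesis by blast
qed

section \<open>Minimal faces and maximisation of linear functionals\<close>

lemma exposed_face_contains_minimal_face:
  assumes "convex C" "F exposed_face_of C" "F \<noteq> {}"
  shows "\<exists>G. G minimal_face_of C \<and> G \<subseteq> F"
proof -
  define \<F> where "\<F> = {G. G exposed_face_of C \<and> G \<noteq> {} \<and> G \<subseteq> F}"
  have "F \<in> \<F>" using assms by (simp add: \<F>_def)
  \<comment> \<open>Passing to \<open>nat\<close> loses nothing: members of \<open>\<F>\<close> are
    nonempty and so have nonnegative dimension.\<close>
  then obtain G where G: "G \<in> \<F>" and le: "\<And>E. E \<in> \<F> \<Longrightarrow> nat (aff_dim G) \<le> nat (aff_dim E)"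
    using ex_has_least_nat[of "\<lambda>G. G \<in> \<F>" F "\<lambda>G. nat (aff_dim G)"] by blast
  have "E = G" if E: "E exposed_face_of C" "E \<noteq> {}" "E \<subseteq> G" for E
  proof (rule ccontr)
    assume "E \<noteq> G"
    have faces: "E face_of C" "G face_of C"
      using E(1) G by (auto simp: \<F>_def exposed_face_of_def)
    then have "E face_of G" using E(3) by (meson face_of_imp_subset face_of_subset)
    then have "aff_dim E < aff_dim G"
      using face_of_aff_dim_lt face_of_imp_convex faces \<open>E \<noteq> G\<close> by blast
    moreover have "0 \<le> aff_dim E" using E(2) aff_dim_negative_iff[of E] by linarith
    moreover have "E \<in> \<F>" using E G by (auto simp: \<F>_def)
    ultimately show False using le by fastforce
  qed
  with G show ?thesis unfolding \<F>_def minimal_face_of_def by blast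
qed

text \<open>The cone contributes only nonpositive values, so the maximum over the compact set
  \<open>convex hull V\<close> is the maximum over \<open>X\<close>.\<close>

lemma linear_attains_max_conv_plus_cone:
  fixes V R :: "'a::euclidean_space set"
  assumes X: "X = convex hull V + convex_cone hull R" "X \<noteq> {}" and V: "finite V"
    and c: "\<And>r. r \<in> R \<Longrightarrow> c \<bullet> r \<le> 0"
  shows "\<exists>w\<in>X. \<forall>x\<in>X. c \<bullet> x \<le> c \<bullet> w"
proof -
  have "V \<noteq> {}" using X by auto
  have "compact (convex hull V)" using V by (simp add: compact_convex_hull finite_imp_compact)
  moreover have "convex hull V \<noteq> {}" using \<open>V \<noteq> {}\<close> by simp
  ultimately obtain w where w: "w \<in> convex hull V" "\<forall>x\<in>convex hull V. c \<bullet> x \<le> c \<bullet> w"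
    using continuous_attains_sup[of "convex hull V" "\<lambda>x. c \<bullet> x"]
      continuous_on_inner[OF continuous_on_const continuous_on_id, of "convex hull V" c] by auto
  have "convex_cone hull R \<subseteq> {y. c \<bullet> y \<le> 0}"
    using c by (intro hull_minimal convex_cone_halfspace_le) auto
  with w have "\<forall>x\<in>X. c \<bullet> x \<le> c \<bullet> w"
    unfolding X(1) set_plus_def by (fastforce simp: inner_add_right)
  moreover have "w \<in> X"
    unfolding X(1) using set_plus_intro[OF w(1) convex_cone_hull_contains_0] by simp
  ultimately show ?thesis by blast
qed

text \<open>Otherwise adding \<open>r\<close> repeatedly to \<open>x\<close> would exceed the bound
  \<open>b\<close>.\<close>

lemma bdd_above_imp_inner_recession_nonpos:
  assumes "x \<in> D" "\<And>y. y \<in> D \<Longrightarrow> c \<bullet> y \<le> b" "\<And>y. y \<in> D \<Longrightarrow> y + r \<in> D"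
  shows "c \<bullet> r \<le> 0"
proof (rule ccontr)
  assume "\<not> c \<bullet> r \<le> 0"
  then obtain n where n: "b - c \<bullet> x < real n * (c \<bullet> r)" using reals_Archimedean3[of "c \<bullet> r"] by auto
  have "x + real m *\<^sub>R r \<in> D" for m
  proof (induction m)
    case (Suc m)
    then show ?case using assms(3)[OF Suc] by (simp add: algebra_simps)
  qed (simp add: assms(1))
  then have "c \<bullet> (x + real n *\<^sub>R r) \<le> b" by (rule assms(2))
  then show False using n by (simp add: inner_add_right)
qed

text \<open>A functional separating a point of \<open>X\<close> from \<open>D\<close> is bounded above on \<open>D\<close>, hence nonpositive on
  the common recession directions \<open>R\<close>, hence it attains its maximum over \<open>X\<close>.\<close>

lemma conv_plus_cone_subset_by_maximisers:
  fixes V R :: "'a::euclidean_space set"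
  assumes X: "X = convex hull V + convex_cone hull R" and V: "finite V"
    and D: "convex D" "closed D" "\<And>r x. r \<in> R \<Longrightarrow> x \<in> D \<Longrightarrow> x + r \<in> D"
    and max: "\<And>c w. w \<in> X \<Longrightarrow> \<forall>x\<in>X. c \<bullet> x \<le> c \<bullet> w \<Longrightarrow> \<exists>y\<in>D. \<forall>x\<in>X. c \<bullet> x \<le> c \<bullet> y"
  shows "X \<subseteq> D"
proof
  fix x assume x: "x \<in> X"
  \<comment> \<open>The zero functional is maximised everywhere on \<open>X\<close>, so the
    hypothesis on maximisers shows that \<open>D\<close> is nonempty.\<close>
  then obtain d where d: "d \<in> D" using max[of x 0] by auto
  show "x \<in> D"
  proof (rule ccontr)
    assume "x \<notin> D"
    then obtain a b where ab: "a \<bullet> x < b" "\<forall>y\<in>D. a \<bullet> y > b"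
      using separating_hyperplane_closed_point[OF D(1,2)] by blast
    have "(- a) \<bullet> r \<le> 0" if "r \<in> R" for r
      using ab(2) D(3)[OF that] by (intro bdd_above_imp_inner_recession_nonpos[OF d, of _ "- b"]) auto
    then obtain w where "w \<in> X" "\<forall>x\<in>X. (- a) \<bullet> x \<le> (- a) \<bullet> w"
      using linear_attains_max_conv_plus_cone[OF X _ V] x by blast
    then obtain y where "y \<in> D" "\<forall>x\<in>X. (- a) \<bullet> x \<le> (- a) \<bullet> y" using max by blast
    \<comment> \<open>Maximality gives \<open>a \<bullet> y \<le> a \<bullet> x < b\<close>, while
      \<open>y \<in> D\<close> forces \<open>a \<bullet> y > b\<close>.\<close>
    then show False using ab x by force
  qed
qed

text \<open>The sum of a compact set and a closed set is closed. This is what permits strict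
  separation from the mixed-integer hull.\<close>

lemma closed_conv_plus_cone:
  fixes V R :: "'a::euclidean_space set"
  assumes "finite V" "finite R"
  shows "closed (convex hull V + convex_cone hull R)"
proof -
  have "convex hull V + convex_cone hull R = (\<Union>x\<in>convex hull V. \<Union>y\<in>convex_cone hull R. {x + y})"
    by (auto simp: set_plus_def)
  then show ?thesis
    using assms by (simp add: compact_closed_sums compact_convex_hull finite_imp_compact closed_convex_cone_hull)
qed

section \<open>Integral fibers\<close>

text \<open>Each fixed coordinate amounts to two opposite inequalities with integer data. Fibers
  therefore have decompositions with integral directions too.\<close>

lemma rational_polyhedron_integral_fiber:
  assumes "rational_polyhedron P"
  shows "rational_polyhedron (integral_fiber P S k)"
proof -
  obtain H where H: "finite H" "\<forall>(a, b)\<in>H. (\<forall>i. a $ i \<in> \<rat>) \<and> b \<in> \<rat>"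
      "P = {x. \<forall>(a, b)\<in>H. a \<bullet> x \<le> b}"
    using assms unfolding rational_polyhedron_def by blast
  let ?H = "H \<union> (\<lambda>i. (axis i 1, of_int (k i))) ` S \<union> (\<lambda>i. (- axis i 1, - of_int (k i))) ` S"
  have "integral_fiber P S k = {x. \<forall>(a, b)\<in>?H. a \<bullet> x \<le> b}"
    unfolding integral_fiber_def H(3) by (auto simp: inner_axis' ball_Un intro: antisym)
  moreover have "\<forall>(a, b)\<in>?H. (\<forall>i. a $ i \<in> \<rat>) \<and> b \<in> \<rat>"
    using H(2) by (auto simp: axis_def)
  ultimately show ?thesis
    unfolding rational_polyhedron_def using H(1) by (intro exI[of _ ?H]) auto
qed

text \<open>Every inequality of \<open>P\<close> is bounded on the nonempty set \<open>Q\<close>, so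
  its normal vector has nonpositive product with \<open>r\<close>.\<close>

lemma rational_polyhedron_recession:
  assumes "rational_polyhedron P" "Q \<subseteq> P" "x \<in> Q" "\<And>y. y \<in> Q \<Longrightarrow> y + r \<in> Q" "z \<in> P"
  shows "z + r \<in> P"
proof -
  obtain H where P: "P = {x. \<forall>(a, b)\<in>H. a \<bullet> x \<le> b}"
    using assms(1) unfolding rational_polyhedron_def by blast
  have "a \<bullet> (z + r) \<le> b" if "(a, b) \<in> H" for a b
  proof -
    have le: "a \<bullet> y \<le> b" if "y \<in> P" for y using \<open>(a, b) \<in> H\<close> that P by auto
    then have "a \<bullet> r \<le> 0"
      using assms(2) by (intro bdd_above_imp_inner_recession_nonpos[OF assms(3) _ assms(4)]) auto
    with le[OF assms(5)] show ?thesis by (simp add: inner_add_right)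
  qed
  then show ?thesis unfolding P by auto
qed

lemma Union_integral_fibers:
  "(\<Union>k \<in> S \<rightarrow>\<^sub>E (UNIV :: int set). integral_fiber P S k) = P \<inter> mixed_integer_set S"
proof
  show "(\<Union>k \<in> S \<rightarrow>\<^sub>E (UNIV :: int set). integral_fiber P S k) \<subseteq> P \<inter> mixed_integer_set S"
    by (auto simp: integral_fiber_def mixed_integer_set_def)
  show "P \<inter> mixed_integer_set S \<subseteq> (\<Union>k \<in> S \<rightarrow>\<^sub>E (UNIV :: int set). integral_fiber P S k)"
  proof
    fix x assume "x \<in> P \<inter> mixed_integer_set S"
    then have "x \<in> integral_fiber P S (restrict (\<lambda>i. \<lfloor>x $ i\<rfloor>) S)"
      by (auto simp: integral_fiber_def mixed_integer_set_def)
    then show "x \<in> (\<Union>k \<in> S \<rightarrow>\<^sub>E (UNIV :: int set). integral_fiber P S k)"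
      by (intro UN_I[of "restrict (\<lambda>i. \<lfloor>x $ i\<rfloor>) S"]) auto
  qed
qed

lemma implied_integer_iff_subset:
  "implied_integer P S T \<longleftrightarrow>
    convex hull (P \<inter> mixed_integer_set S) \<subseteq> convex hull (P \<inter> mixed_integer_set (S \<union> T))"
proof -
  have "convex hull (P \<inter> mixed_integer_set (S \<union> T)) \<subseteq> convex hull (P \<inter> mixed_integer_set S)"
    by (intro hull_mono) (auto simp: mixed_integer_set_def)
  then show ?thesis unfolding implied_integer_def by blast
qed

text \<open>A convex set contains a hull as soon as it contains the points spanning it, and the
  mixed-integer points of \<open>P\<close> are the union of the fibers.\<close>

lemma implied_integer_iff_fibers:
  "implied_integer P S T \<longleftrightarrow>
    (\<forall>k \<in> S \<rightarrow>\<^sub>E (UNIV :: int set). integral_fiber P S k \<subseteq> convex hull (P \<inter> mixed_integer_set (S \<union> T)))"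
  (is "_ \<longleftrightarrow> (\<forall>k \<in> _. _ \<subseteq> ?D)")
proof -
  have "implied_integer P S T \<longleftrightarrow> P \<inter> mixed_integer_set S \<subseteq> ?D"
    unfolding implied_integer_iff_subset
    by (metis convex_convex_hull hull_minimal hull_subset order_trans)
  then show ?thesis unfolding Union_integral_fibers[symmetric] by blast
qed

text \<open>If \<open>X\<close> missed the supporting hyperplane, it would lie in an open halfspace;
  that is convex, so the whole hull would miss the hyperplane.\<close>

lemma exposed_face_of_convex_hull_meets:
  assumes "F exposed_face_of (convex hull X)" "F \<noteq> {}"
  shows "F \<inter> X \<noteq> {}"
proof
  assume disj: "F \<inter> X = {}"
  obtain a b where ab: "convex hull X \<subseteq> {x. a \<bullet> x \<le> b}" "F = convex hull X \<inter> {x. a \<bullet> x = b}"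
    using assms(1) unfolding exposed_face_of_def by auto
  have "X \<subseteq> {x. a \<bullet> x < b}"
    using ab disj hull_subset[of X convex] by force
  then have "convex hull X \<subseteq> {x. a \<bullet> x < b}"
    by (intro hull_minimal convex_halfspace_lt)
  with ab(2) assms(2) show False by auto
qed

lemma maximisers_exposed_face:
  assumes "convex C" "w \<in> C" "\<forall>x\<in>C. c \<bullet> x \<le> c \<bullet> w"
  shows "C \<inter> {x. c \<bullet> x = c \<bullet> w} exposed_face_of C" "C \<inter> {x. c \<bullet> x = c \<bullet> w} \<noteq> {}"
proof -
  show "C \<inter> {x. c \<bullet> x = c \<bullet> w} exposed_face_of C"
    by (rule exposed_face_of_Int_supporting_hyperplane_le) (use assms in blast)+
  show "C \<inter> {x. c \<bullet> x = c \<bullet> w} \<noteq> {}" using assms(2) by blast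
qed

section \<open>Equivalence of the five conditions\<close>

theorem theorem3:
  fixes P :: "(real^'n) set" and S T :: "'n set"
  assumes "rational_polyhedron P"
  shows
    "(implied_integer P S T \<longleftrightarrow>
       (\<forall>F. F minimal_face_of (convex hull (P \<inter> mixed_integer_set S)) \<longrightarrow>
          (\<exists>x \<in> F. x \<in> mixed_integer_set (S \<union> T)))) \<and>
     (implied_integer P S T \<longleftrightarrow>
       (\<forall>c :: real^'n.
          convex hull (P \<inter> mixed_integer_set S) \<noteq> {} \<and>
          bdd_above ((\<lambda>x. c \<bullet> x) ` (convex hull (P \<inter> mixed_integer_set S))) \<longrightarrow>
          (\<exists>xstar \<in> convex hull (P \<inter> mixed_integer_set S).
             xstar \<in> mixed_integer_set (S \<union> T) \<and>
             (\<forall>x \<in> convex hull (P \<inter> mixed_integer_set S). c \<bullet> x \<le> c \<bullet> xstar)))) \<and>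
     (implied_integer P S T \<longleftrightarrow>
       (\<forall>xbar \<in> S \<rightarrow>\<^sub>E (UNIV :: int set). \<forall>F. F minimal_face_of (integral_fiber P S xbar) \<longrightarrow>
          F \<subseteq> convex hull (P \<inter> mixed_integer_set (S \<union> T)))) \<and>
     (implied_integer P S T \<longleftrightarrow>
       (\<forall>xbar \<in> S \<rightarrow>\<^sub>E (UNIV :: int set).
          integral_fiber P S xbar \<subseteq> convex hull (P \<inter> mixed_integer_set (S \<union> T))))"
    (is "(?i \<longleftrightarrow> ?ii) \<and> (?i \<longleftrightarrow> ?iii) \<and> (?i \<longleftrightarrow> ?iv) \<and> (?i \<longleftrightarrow> ?v)")
proof -
  let ?C = "convex hull (P \<inter> mixed_integer_set S)"
  let ?D = "convex hull (P \<inter> mixed_integer_set (S \<union> T))"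
  have poly: "polyhedron P" by (rule rational_polyhedron_imp_polyhedron[OF assms])
  obtain V R where VR: "finite V" "finite R" "R \<subseteq> mixed_integer_set UNIV"
      "P = convex hull V + convex_cone hull R"
    using rational_polyhedron_decomposition[OF assms] by blast
  \<comment> \<open>The directions \<open>R\<close> depend on \<open>P\<close> alone, so the same
    cone serves both hulls.\<close>
  obtain W where W: "finite W" "?C = convex hull W + convex_cone hull R"
    using mixed_integer_hull_decomposition[OF poly VR(4,1,2,3)] by blast
  obtain U where U: "finite U" "?D = convex hull U + convex_cone hull R"
    using mixed_integer_hull_decomposition[OF poly VR(4,1,2,3)] by blast
  have closed: "closed ?D" unfolding U(2) by (intro closed_conv_plus_cone U(1) VR(2))
  have add: "x + r \<in> convex hull A + convex_cone hull B"
    if "x \<in> convex hull A + convex_cone hull B" "r \<in> B" for x r and A B :: "(real^'n) set"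
    using that convex_cone_hull_add[OF _ hull_inc[OF that(2), of convex_cone]]
    unfolding set_plus_def by (fastforce simp: add.assoc)
  \<comment> \<open>By (i) the face is an exposed face of \<open>?D\<close>, hence contains one of
    the mixed-integer points spanning \<open>?D\<close>.\<close>
  have i_ii: "?ii" if ?i
  proof (intro allI impI)
    fix F assume "F minimal_face_of ?C"
    with that have "F exposed_face_of ?D" "F \<noteq> {}"
      by (auto simp: minimal_face_of_def implied_integer_def)
    then show "\<exists>x\<in>F. x \<in> mixed_integer_set (S \<union> T)"
      using exposed_face_of_convex_hull_meets by blast
  qed
  have ii_iii: "?iii" if ?ii
  proof (intro allI impI, elim conjE)
    fix c :: "real^'n"
    assume ne: "?C \<noteq> {}" and "bdd_above ((\<lambda>x. c \<bullet> x) ` ?C)"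
    then obtain b where b: "\<And>y. y \<in> ?C \<Longrightarrow> c \<bullet> y \<le> b"
      unfolding bdd_above_def by blast
    obtain x where x: "x \<in> ?C" using ne by blast
    have "c \<bullet> r \<le> 0" if "r \<in> R" for r
    proof (rule bdd_above_imp_inner_recession_nonpos[OF x b])
      show "y + r \<in> ?C" if "y \<in> ?C" for y
        using add[of y W R r] that \<open>r \<in> R\<close> unfolding W(2) by blast
    qed
    then obtain w where w: "w \<in> ?C" "\<forall>x\<in>?C. c \<bullet> x \<le> c \<bullet> w"
      using linear_attains_max_conv_plus_cone[OF W(2) ne W(1)] by blast
    \<comment> \<open>The maximisers form an exposed face; (ii) applies to a minimal face inside
      it.\<close>
    obtain G where G: "G minimal_face_of ?C" "G \<subseteq> ?C \<inter> {x. c \<bullet> x = c \<bullet> w}"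
      using exposed_face_contains_minimal_face[OF convex_convex_hull
          maximisers_exposed_face[OF convex_convex_hull w]] by blast
    then obtain y where "y \<in> G" "y \<in> mixed_integer_set (S \<union> T)" using \<open>?ii\<close> by blast
    with G(2) w(2) show "\<exists>xstar\<in>?C. xstar \<in> mixed_integer_set (S \<union> T) \<and> (\<forall>x\<in>?C. c \<bullet> x \<le> c \<bullet> xstar)"
      by (intro bexI[of _ y]) auto
  qed
  have iii_i: "?i" if ?iii
    unfolding implied_integer_iff_subset
  proof (rule conv_plus_cone_subset_by_maximisers[OF W(2,1) convex_convex_hull closed])
    show "x + r \<in> ?D" if "r \<in> R" "x \<in> ?D" for r x
      using that add unfolding U(2) by blast
    fix c w assume w: "w \<in> ?C" "\<forall>x\<in>?C. c \<bullet> x \<le> c \<bullet> w"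
    then have "bdd_above ((\<lambda>x. c \<bullet> x) ` ?C)" by (intro bdd_aboveI[of _ "c \<bullet> w"]) auto
    with \<open>?iii\<close> w(1) obtain y where y: "y \<in> ?C" "y \<in> mixed_integer_set (S \<union> T)" "\<forall>x\<in>?C. c \<bullet> x \<le> c \<bullet> y"
      by blast
    \<comment> \<open>Membership in \<open>P\<close> makes \<open>y\<close> one of the points
      spanning \<open>?D\<close>.\<close>
    have "?C \<subseteq> P" by (intro hull_minimal polyhedron_imp_convex poly) auto
    with y show "\<exists>y\<in>?D. \<forall>x\<in>?C. c \<bullet> x \<le> c \<bullet> y"
      by (intro bexI[of _ y] hull_inc) auto
  qed
  have i_v: "?i \<longleftrightarrow> ?v" by (rule implied_integer_iff_fibers)
  have v_iv: "?iv" if ?v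
    using that by (meson minimal_face_of_def exposed_face_of_def face_of_imp_subset order_trans)
  have iv_v: "?v" if ?iv
  proof
    fix k assume k: "k \<in> S \<rightarrow>\<^sub>E (UNIV :: int set)"
    let ?Q = "integral_fiber P S k"
    have rat: "rational_polyhedron ?Q" by (rule rational_polyhedron_integral_fiber[OF assms])
    obtain V' R' where Q: "finite V'" "R' \<subseteq> mixed_integer_set UNIV"
        "?Q = convex hull V' + convex_cone hull R'"
      using rational_polyhedron_decomposition[OF rat] by blast
    have "convex ?Q" by (intro polyhedron_imp_convex rational_polyhedron_imp_polyhedron rat)
    show "?Q \<subseteq> ?D"
    \<comment> \<open>A point of the fiber is needed to transfer its recession directions to
      \<open>P\<close>.\<close>
    proof (cases "?Q = {}")
      case False
      then obtain q where q: "q \<in> ?Q" by blast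
      show ?thesis
      proof (rule conv_plus_cone_subset_by_maximisers[OF Q(3,1) convex_convex_hull closed])
        \<comment> \<open>The directions \<open>R'\<close> come from the fiber, not from
          \<open>P\<close>. Being integral and also recession directions of \<open>P\<close>, they
          still leave \<open>?D\<close> invariant.\<close>
        fix r x assume r: "r \<in> R'" and x: "x \<in> ?D"
        have "y + r \<in> ?Q" if "y \<in> ?Q" for y using add[of y V' R' r] that r Q(3) by simp
        then have "z + r \<in> P" if "z \<in> P" for z
          using that by (intro rational_polyhedron_recession[OF assms _ q])
            (auto simp: integral_fiber_def)
        with Q(2) r x show "x + r \<in> ?D"
          by (intro convex_hull_mixed_integer_add_integral) auto
      next
        fix c w assume w: "w \<in> ?Q" "\<forall>x\<in>?Q. c \<bullet> x \<le> c \<bullet> w"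
        obtain G where G: "G minimal_face_of ?Q" "G \<subseteq> ?Q \<inter> {x. c \<bullet> x = c \<bullet> w}"
          using exposed_face_contains_minimal_face[OF \<open>convex ?Q\<close>
              maximisers_exposed_face[OF \<open>convex ?Q\<close> w]] by blast
        \<comment> \<open>By (iv) all of \<open>G\<close> lies in \<open>?D\<close>, and minimal
          faces are nonempty.\<close>
        then obtain y where "y \<in> G" "y \<in> ?D" using \<open>?iv\<close> k by (fastforce simp: minimal_face_of_def)
        with G(2) w(2) show "\<exists>y\<in>?D. \<forall>x\<in>?Q. c \<bullet> x \<le> c \<bullet> y"
          by (intro bexI[of _ y]) auto
      qed
    qed simp
  qed
  have "?i \<longleftrightarrow> ?ii" by (rule iffI) (erule i_ii, erule iii_i[OF ii_iii])
  moreover have "?i \<longleftrightarrow> ?iii" by (rule iffI) (erule ii_iii[OF i_ii], erule iii_i)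
  moreover have "?i \<longleftrightarrow> ?iv" unfolding i_v by (rule iffI) (erule v_iv, erule iv_v)
  ultimately show ?thesis using i_v by (intro conjI)
qed

end
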